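(* Let $V$ be a finite non-empty set. For all $p,q\ge0$ and all $\varphi\in\Lambda^p$, $\psi\in\Lambda^q$, $$d(\varphi\psi)=(d\varphi)\psi+(-1)^p\varphi\, d\psi.$$
   Context: Fix a field $\mathbb K$. For $p\ge0$, $\Lambda^p=\Lambda^p(V)$ is the space of all $\mathbb K$-valued functions ($p$-forms) on $V^{p+1}$; the value of $\omega\in\Lambda^p$ at $(i_0,\dots,i_p)$ is written $\omega_{i_0\dots i_p}$. The exterior differential $d:\Lambda^p\to\Lambda^{p+1}$ is $(d\omega)_{i_0\dots i_{p+1}}=\sum_{q=0}^{p+1}(-1)^q\omega_{i_0\dots\widehat{i_q}\dots i_{p+1}}$ (hat denotes omission). The concatenation $\varphi\psi\in\Lambda^{p+q}$ of $\varphi\in\Lambda^p$ and $\psi\in\Lambda^q$ is $(\varphi\psi)_{i_0\dots i_{p+q}}=\varphi_{i_0\dots i_p}\psi_{i_pi_{p+1}\dots i_{p+q}}$. *)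

theory Defs
  imports Complex_Main "HOL-Library.FuncSet"
begin

text \<open>A tuple \<open>(i\<^sub>0, \<dots>, i\<^sub>p)\<close> of \<open>V\<^sup>p\<^sup>+\<^sup>1\<close> is encoded as a list of length \<open>p + 1\<close>
  with entries in \<open>V\<close>; the entry \<open>i\<^sub>k\<close> is \<open>i ! k\<close>.\<close>

definition tuples :: "'v set \<Rightarrow> nat \<Rightarrow> 'v list set" where
  "tuples V p = {i \<in> lists V. length i = p + 1}"

text \<open>Forms are extensional functions (\<open>undefined\<close> off \<open>V\<^sup>p\<^sup>+\<^sup>1\<close>), so that equality of forms is
  equality of functions on \<open>V\<^sup>p\<^sup>+\<^sup>1\<close>. As the degree cannot be read off from the HOL type of a
  form, it is an explicit argument of the operations below.\<close>

definition forms :: "'v set \<Rightarrow> nat \<Rightarrow> ('v list \<Rightarrow> 'k::field) set" where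
  "forms V p = tuples V p \<rightarrow>\<^sub>E UNIV"

definition omit :: "nat \<Rightarrow> 'v list \<Rightarrow> 'v list" where
  "omit r i = take r i @ drop (r + 1) i"

definition form_diff :: "'v set \<Rightarrow> nat \<Rightarrow> ('v list \<Rightarrow> 'k::field) \<Rightarrow> 'v list \<Rightarrow> 'k" where
  "form_diff V p \<omega> = (\<lambda>i\<in>tuples V (p + 1). \<Sum>r=0..p + 1. (-1) ^ r * \<omega> (omit r i))"

text \<open>The entry \<open>i\<^sub>p\<close> is shared: \<open>take (p + 1) i\<close> is \<open>(i\<^sub>0, \<dots>, i\<^sub>p)\<close> and \<open>drop p i\<close> is
  \<open>(i\<^sub>p, \<dots>, i\<^sub>p\<^sub>+\<^sub>q)\<close>.\<close>

definition form_concat ::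
  "'v set \<Rightarrow> nat \<Rightarrow> nat \<Rightarrow> ('v list \<Rightarrow> 'k::field) \<Rightarrow> ('v list \<Rightarrow> 'k) \<Rightarrow> 'v list \<Rightarrow> 'k" where
  "form_concat V p q \<phi> \<psi> = (\<lambda>i\<in>tuples V (p + q). \<phi> (take (p + 1) i) * \<psi> (drop p i))"

definition form_add ::
  "'v set \<Rightarrow> nat \<Rightarrow> ('v list \<Rightarrow> 'k::field) \<Rightarrow> ('v list \<Rightarrow> 'k) \<Rightarrow> 'v list \<Rightarrow> 'k" where
  "form_add V p \<alpha> \<beta> = (\<lambda>i\<in>tuples V p. \<alpha> i + \<beta> i)"

definition form_scale ::
  "'v set \<Rightarrow> nat \<Rightarrow> 'k::field \<Rightarrow> ('v list \<Rightarrow> 'k) \<Rightarrow> 'v list \<Rightarrow> 'k" where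
  "form_scale V p c \<alpha> = (\<lambda>i\<in>tuples V p. c * \<alpha> i)"

lemma omit_in_tuples:
  assumes "i \<in> tuples V (p + 1)" and "r \<le> p + 1"
  shows "omit r i \<in> tuples V p"
  using assms by (auto simp: tuples_def omit_def dest: in_set_takeD in_set_dropD)

lemma take_in_tuples: "i \<in> tuples V (p + q) \<Longrightarrow> take (p + 1) i \<in> tuples V p"
  by (auto simp: tuples_def dest: in_set_takeD)

lemma drop_in_tuples: "i \<in> tuples V (p + q) \<Longrightarrow> drop p i \<in> tuples V q"
  by (auto simp: tuples_def dest: in_set_dropD)

lemma form_diff_in_forms: "form_diff V p \<omega> \<in> forms V (p + 1)"
  by (simp add: form_diff_def forms_def)

lemma form_concat_in_forms: "form_concat V p q \<phi> \<psi> \<in> forms V (p + q)"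
  by (simp add: form_concat_def forms_def)

end

theory Submission
  imports Defs
begin

text \<open>At a tuple \<open>i\<close>, the differential of \<open>\<phi>\<psi>\<close> is an alternating sum over the deleted position
  \<open>r\<close>. A position \<open>r \<le> p\<close> is deleted from the part that \<open>\<phi>\<close> sees, and \<open>\<psi>\<close> then starts at
  \<open>i\<^sub>p\<^sub>+\<^sub>1\<close>; a position \<open>r \<ge> p + 1\<close> is deleted from the part that \<open>\<psi>\<close> sees, and \<open>\<phi>\<close> still ends at
  \<open>i\<^sub>p\<close>. These are the summands \<open>r \<le> p\<close> of \<open>(d\<phi>)\<psi>\<close> and the summands \<open>s = r - p \<ge> 1\<close> of
  \<open>(-1)\<^sup>p \<phi> d\<psi>\<close>. Two summands of the right-hand side remain, the last one of \<open>d\<phi>\<close> and the first one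
  of \<open>d\<psi>\<close>. Both are \<open>\<phi>(i\<^sub>0, \<dots>, i\<^sub>p) \<psi>(i\<^sub>p\<^sub>+\<^sub>1, \<dots>)\<close> up to sign, with signs \<open>(-1)\<^sup>p\<^sup>+\<^sup>1\<close> and \<open>(-1)\<^sup>p\<close>,
  so they cancel.\<close>

lemma take_omit_left: "r \<le> n \<Longrightarrow> n < length i \<Longrightarrow> take n (omit r i) = omit r (take (Suc n) i)"
  by (simp add: omit_def min_def take_drop)

lemma drop_omit_left: "r \<le> n \<Longrightarrow> n < length i \<Longrightarrow> drop n (omit r i) = drop (Suc n) i"
  by (simp add: omit_def)

lemma take_omit_right: "n \<le> r \<Longrightarrow> r < length i \<Longrightarrow> take n (omit r i) = take n i"
  by (simp add: omit_def min_def)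

lemma drop_omit_right: "r < length i \<Longrightarrow> n \<le> r \<Longrightarrow> drop n (omit r i) = omit (r - n) (drop n i)"
  by (simp add: omit_def drop_take)

lemma omit_0: "omit 0 i = drop 1 i"
  by (simp add: omit_def)

lemma omit_last: "length i = Suc n \<Longrightarrow> omit n i = take n i"
  by (simp add: omit_def)

text \<open>The sum on the left is split after \<open>r = p\<close>. The two parts are the sums on the right, the first
  without its last summand and the second without its first one; these two cancel.\<close>

lemma alternating_sum_concat:
  fixes \<phi> \<psi> :: "'v list \<Rightarrow> 'k::comm_ring_1"
  assumes len: "length i = p + q + 2"
  shows "(\<Sum>r=0..p + q + 1. (-1) ^ r * (\<phi> (take (p + 1) (omit r i)) * \<psi> (drop p (omit r i)))) =
    (\<Sum>r=0..p + 1. (-1) ^ r * \<phi> (omit r (take (p + 2) i))) * \<psi> (drop (p + 1) i) +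
    (-1) ^ p * (\<phi> (take (p + 1) i) * (\<Sum>s=0..q + 1. (-1) ^ s * \<psi> (omit s (drop p i))))"
    (is "sum ?f _ = ?L * _ + _ * (_ * ?R)")
proof -
  let ?a = "\<phi> (take (p + 1) i)" and ?b = "\<psi> (drop (p + 1) i)"
  have left: "sum ?f {0..p} = (\<Sum>r=0..p. (-1) ^ r * \<phi> (omit r (take (p + 2) i))) * ?b"
    using len by (simp add: sum_distrib_right take_omit_left drop_omit_left mult.assoc)
  have "sum ?f {p + 1..p + q + 1} = (\<Sum>s=1..q + 1. ?f (s + p))"
    using sum.shift_bounds_cl_nat_ivl[of ?f 1 p "q + 1"] by (simp add: ac_simps)
  also have "\<dots> = (-1) ^ p * (?a * (\<Sum>s=1..q + 1. (-1) ^ s * \<psi> (omit s (drop p i))))"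
    unfolding sum_distrib_left
    using len by (intro sum.cong) (auto simp: take_omit_right drop_omit_right power_add)
  finally have right: "sum ?f {p + 1..p + q + 1} = \<dots>" .
  \<comment> \<open>\<open>L\<close> and \<open>R\<close> separate the cancelling summands, \<open>r = p + 1\<close> and \<open>s = 0\<close>; the first has sign
    \<open>(-1)\<^sup>p\<^sup>+\<^sup>1\<close>, hence the subtraction.\<close>
  have L: "?L = (\<Sum>r=0..p. (-1) ^ r * \<phi> (omit r (take (p + 2) i))) - (-1) ^ p * ?a"
    using len by (simp add: omit_last)
  have R: "?R = ?b + (\<Sum>s=1..q + 1. (-1) ^ s * \<psi> (omit s (drop p i)))"
    by (subst sum.atLeast_Suc_atMost) (simp_all add: omit_0)
  have "sum ?f {0..p + q + 1} = sum ?f {0..p} + sum ?f {p + 1..p + q + 1}"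
    using sum.ub_add_nat[of 0 p ?f "q + 1"] by (simp add: add.assoc)
  then show ?thesis
    unfolding left right L R by (simp only: algebra_simps)
qed

theorem lemma2p16:
  fixes V :: "'v set" and p q :: nat and \<phi> \<psi> :: "'v list \<Rightarrow> 'k::field"
  assumes "finite V" and "V \<noteq> {}"
    and "\<phi> \<in> forms V p" and "\<psi> \<in> forms V q"
  shows "form_diff V (p + q) (form_concat V p q \<phi> \<psi>) =
    form_add V (p + q + 1)
      (form_concat V (p + 1) q (form_diff V p \<phi>) \<psi>)
      (form_scale V (p + q + 1) ((-1) ^ p) (form_concat V p (q + 1) \<phi> (form_diff V q \<psi>)))"
    (is "?lhs = ?rhs")
proof
  fix i
  show "?lhs i = ?rhs i"
  proof (cases "i \<in> tuples V (p + q + 1)")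
    case True
    have i: "i \<in> tuples V (p + 1 + q)" "i \<in> tuples V (p + (q + 1))"
      using True by (simp_all add: ac_simps)
    have len: "length i = p + q + 2"
      using True by (simp add: tuples_def)
    have "?lhs i = (\<Sum>r=0..p + q + 1.
        (-1) ^ r * (\<phi> (take (p + 1) (omit r i)) * \<psi> (drop p (omit r i))))"
      unfolding form_diff_def form_concat_def restrict_apply'[OF True]
      by (intro sum.cong refl) (use omit_in_tuples[OF True] in simp)
    also have "\<dots> = form_diff V p \<phi> (take (p + 1 + 1) i) * \<psi> (drop (p + 1) i) +
        (-1) ^ p * (\<phi> (take (p + 1) i) * form_diff V q \<psi> (drop p i))"
      using alternating_sum_concat[OF len, of \<phi> \<psi>] take_in_tuples[OF i(1)] drop_in_tuples[OF i(2)]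
      by (simp add: form_diff_def del: sum.atLeast0_atMost_Suc)
    also have "\<dots> = ?rhs i"
      unfolding form_add_def form_scale_def form_concat_def
        restrict_apply'[OF True] restrict_apply'[OF i(1)] restrict_apply'[OF i(2)] ..
    finally show ?thesis .
  next
    case False
    then show ?thesis
      by (simp add: form_diff_def form_add_def)
  qed
qed

end
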